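(* Let $x\in(0,1)$, $n\in\mathbb{N}$, and let $\phi\in DB([0,1])$, that is, $\phi(y)=\phi(x)+\int_x^y f(u)\,du$ for $y\in[0,1]$, with $f\in B([0,1])$, and let $g=f_x$. Then $$|B_n(\phi,x)-\phi(x)-x(1-x)P(S_{n-1}(x)=\lfloor nx\rfloor)(f(x+)-f(x-))|$$ $$\leq 2 \exp\left(\frac{x(1-x)}{2}\left(1+\frac{x^2+(1-x)^2}{3\sqrt{n}}\, \exp\left(\frac{1}{\sqrt{n}}\right)\right)\right)\times \frac{1}{n}\sum_{k=0}^{\lceil \sqrt{n}\rceil-1}\omega\left(g,\frac{1}{\sqrt{n}}\log \frac{n}{k}\right).$$
   Context: $\mathbb{N}$ is the set of positive integers, $1_A$ denotes the indicator function of $A$, and $\lfloor y\rfloor$, $\lceil y\rceil$ are the floor and ceiling of $y\in\mathbb{R}$. The Bernstein polynomials are $$B_n(f,x)=\sum_{k=0}^{n}f\left(\frac{k}{n}\right)\binom{n}{k}x^k(1-x)^{n-k}.$$ $S_m(x)$ is a random variable with the binomial law with parameters $m$ and $x$: $P(S_m(x)=k)=\binom{m}{k}x^k(1-x)^{m-k}$, $k=0,\ldots,m$ (with $S_0(x)=0$). For fixed $x\in(0,1)$, $B([0,1])$ is the set of all measurable bounded functions $f:[0,1]\to\mathbb{R}$ whose right and left limits at $x$, denoted $f(x+)$ and $f(x-)$, exist and are finite. $DB([0,1])$ is the set of absolutely continuous functions $\phi$ of the form $\phi(y)=\phi(x)+\int_x^yf(u)\,du$, $y\in[0,1]$, with $f\in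 B([0,1])$. The function $g=f_x$ associated to $f$ is $$f_x(y)=(f(y)-f(x+))1_{(x,1]}(y)+(f(y)-f(x-))1_{[0,x)}(y),\quad y\in[0,1],$$ so $g(x)=0$, and $$\omega(g,\theta)=\sup\{|g(x+u)-g(x)|:\ x+u\in[0,1],\ |u|\leq\theta\},\quad\theta\geq0.$$ Convention: for $k=0$, $\log\frac{n}{0}=\log\infty=\infty$, and $\omega(g,\infty)=\lim_{\theta\to\infty}\omega(g,\theta)$. *)

theory Defs
  imports "HOL-Probability.Probability"
begin

definition bernstein_op :: "nat \<Rightarrow> (real \<Rightarrow> real) \<Rightarrow> real \<Rightarrow> real" where
  "bernstein_op n f x = (\<Sum>k\<le>n. f (real k / real n) * Bernstein n k x)"

text \<open>
  Functions on \<open>[0,1]\<close> are represented by total functions \<open>real \<Rightarrow> real\<close>; all conditions concern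
  only their values on \<open>[0,1]\<close>. The one-sided limits are used only at interior points \<open>x\<close>, so they
  do not see the values outside \<open>[0,1]\<close>. Measurable means Lebesgue measurable.
\<close>

definition right_lim :: "(real \<Rightarrow> real) \<Rightarrow> real \<Rightarrow> real" where
  "right_lim f x = Lim (at_right x) f"

definition left_lim :: "(real \<Rightarrow> real) \<Rightarrow> real \<Rightarrow> real" where
  "left_lim f x = Lim (at_left x) f"

definition B01 :: "real \<Rightarrow> (real \<Rightarrow> real) set" where
  "B01 x = {f. f \<in> borel_measurable (lebesgue_on {0..1}) \<and> bounded (f ` {0..1}) \<and>
               (\<exists>l. (f \<longlongrightarrow> l) (at_right x)) \<and> (\<exists>l. (f \<longlongrightarrow> l) (at_left x))}"

definition abs_cont_on :: "real \<Rightarrow> real \<Rightarrow> (real \<Rightarrow> real) \<Rightarrow> bool" where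
  "abs_cont_on a b \<phi> \<longleftrightarrow>
     (\<forall>\<epsilon>>0. \<exists>\<delta>>0. \<forall>D :: (real \<times> real) set.
        finite D \<longrightarrow> (\<forall>(s, t)\<in>D. a \<le> s \<and> s < t \<and> t \<le> b) \<longrightarrow>
        disjoint_family_on (\<lambda>(s, t). {s<..<t}) D \<longrightarrow>
        (\<Sum>(s, t)\<in>D. t - s) < \<delta> \<longrightarrow> (\<Sum>(s, t)\<in>D. \<bar>\<phi> t - \<phi> s\<bar>) < \<epsilon>)"

text \<open>The interval integral is oriented, hence it changes sign for \<open>y < x\<close>.\<close>

definition is_primitive_from :: "real \<Rightarrow> (real \<Rightarrow> real) \<Rightarrow> (real \<Rightarrow> real) \<Rightarrow> bool" where
  "is_primitive_from x f \<phi> \<longleftrightarrow>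
     (\<forall>y\<in>{0..1}. \<phi> y = \<phi> x + (LINT u=ereal x..ereal y|lebesgue. f u))"

definition DB01 :: "real \<Rightarrow> (real \<Rightarrow> real) set" where
  "DB01 x = {\<phi>. abs_cont_on 0 1 \<phi> \<and> (\<exists>f\<in>B01 x. is_primitive_from x f \<phi>)}"

definition jump_removed :: "(real \<Rightarrow> real) \<Rightarrow> real \<Rightarrow> real \<Rightarrow> real" where
  "jump_removed f x y = (f y - right_lim f x) * indicator {x<..1} y
                      + (f y - left_lim f x) * indicator {0..<x} y"

definition omega :: "real \<Rightarrow> (real \<Rightarrow> real) \<Rightarrow> real \<Rightarrow> real" where
  "omega x g \<theta> = Sup {\<bar>g (x + u) - g x\<bar> |u. x + u \<in> {0..1} \<and> \<bar>u\<bar> \<le> \<theta>}"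

text \<open>Extension to \<open>\<theta> = \<infinity>\<close> by the limit; the value at \<open>-\<infinity>\<close> is never used.\<close>

definition omega_ext :: "real \<Rightarrow> (real \<Rightarrow> real) \<Rightarrow> ereal \<Rightarrow> real" where
  "omega_ext x g \<theta> = (if \<theta> = \<infinity> then Lim at_top (omega x g) else omega x g (real_of_ereal \<theta>))"

definition log_ratio :: "nat \<Rightarrow> nat \<Rightarrow> ereal" where
  "log_ratio n k = (if k = 0 then \<infinity> else ereal (ln (real n / real k)))"

end

theory Submission
  imports Defs
begin

text \<open>
  Write \<open>S\<close> for a binomial variable with parameters \<open>n\<close> and \<open>x\<close>, so that the Bernstein operator at
  \<open>x\<close> is the expectation of \<open>\<phi> (S / n)\<close>. Away from \<open>x\<close> the density \<open>f\<close> is the sum of \<open>g\<close> and of the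
  step function with values \<open>f(x-)\<close> and \<open>f(x+)\<close>. Hence \<open>\<phi> y - \<phi> x\<close> is the sum of the ramp
  \<open>f(x+) max(0, y - x) - f(x-) max(0, x - y)\<close> and of a remainder, the oriented integral of \<open>g\<close>
  from \<open>x\<close> to \<open>y\<close>.

  The ramp contributes exactly the correction term. By de Moivre's formula for the mean absolute
  deviation, the positive and the negative part of \<open>S / n - x\<close> both have expectation
  \<open>x (1 - x) P(S' = \<lfloor>n x\<rfloor>)\<close> with \<open>S'\<close> binomial with parameters \<open>n - 1\<close> and \<open>x\<close>
  (\<open>sum_Bernstein_pos_part\<close>, \<open>sum_Bernstein_neg_part\<close>).

  For the remainder put \<open>s = sqrt n\<close>. Since \<open>g\<close> vanishes at \<open>x\<close>, its size at distance \<open>t\<close> from \<open>x\<close> is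
  at most \<open>\<omega>(g, t)\<close>, so at distance \<open>d\<close> the remainder is at most the integral of \<open>\<omega>(g, t)\<close> over
  \<open>[0, d]\<close>, hence at most \<open>exp(s d)\<close> times the integral of \<open>\<omega>(g, t) exp(- s t)\<close> over
  \<open>[0, \<infinity>)\<close>. With \<open>u = s exp(- s t)\<close> the latter is \<open>1 / n\<close> times the integral over \<open>(0, s]\<close> of the
  nonincreasing function \<open>\<omega>(g, log(s / u) / s)\<close> of \<open>u\<close>, and is bounded by the left Riemann sum over
  \<open>k < s\<close>; replacing \<open>s / k\<close> by \<open>n / k \<ge> s / k\<close> gives the sum in the theorem
  (\<open>primitive_remainder_le\<close>). This estimate is pointwise in \<open>d\<close>, so only the expectation
  of \<open>exp(s \<bar>S / n - x\<bar>)\<close> is left. The moment generating function of \<open>S\<close> at \<open>1 / s\<close> and \<open>- 1 / s\<close>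
  bounds it by the exponential constant (\<open>sum_Bernstein_exp_abs_le\<close>).
\<close>

section \<open>Truncated first moments of the binomial law\<close>

lemma Bernstein_gt: "n < k \<Longrightarrow> Bernstein n k x = 0"
  by (simp add: Bernstein_def binomial_eq_0)

text \<open>
  The deviation from the mean, weighted by the binomial law, is a discrete derivative of the binomial
  law with one trial less: split \<open>k - n x\<close> as \<open>k (1 - x) - (n - k) x\<close> and absorb \<open>k\<close> and \<open>n - k\<close> into
  the binomial coefficient. Truncated first moments therefore telescope.
\<close>

lemma Bernstein_centred_telescope:
  "(real (Suc k) - real (Suc m) * x) * Bernstein (Suc m) (Suc k) x
     = real (Suc m) * x * (1 - x) * (Bernstein m k x - Bernstein m (Suc k) x)"
proof (cases "k < m")
  case False
  then consider "k = m" | "k > m" by linarith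
  then show ?thesis
    by cases (simp_all add: Bernstein_gt, simp add: Bernstein_def algebra_simps)
next
  case True
  define j where "j = m - Suc k"
  have m: "m = Suc (k + j)" using True by (simp add: j_def)
  have 1: "real (Suc k) * real (Suc m choose Suc k) = real (Suc m) * real (m choose k)"
    by (metis Suc_times_binomial_eq of_nat_mult mult.commute)
  have 2: "real (m - k) * real (Suc m choose Suc k) = real (Suc m) * real (m choose Suc k)"
  proof -
    have "(m - k) * (Suc m choose Suc k) = Suc m * (m choose Suc k)"
      using binomial_absorb_comp[of "Suc m" "Suc k"] by simp
    then show ?thesis by (metis of_nat_mult)
  qed
  have "(real (Suc k) - real (Suc m) * x) * real (Suc m choose Suc k)
      = real (Suc k) * real (Suc m choose Suc k) * (1 - x)
        - real (m - k) * real (Suc m choose Suc k) * x"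
    by (simp add: m algebra_simps del: binomial_Suc_Suc)
  also have "\<dots> = real (Suc m) * (real (m choose k) * (1 - x) - real (m choose Suc k) * x)"
    unfolding 1 2 by (simp add: algebra_simps)
  finally have 3: "(real (Suc k) - real (Suc m) * x) * real (Suc m choose Suc k)
     = real (Suc m) * (real (m choose k) * (1 - x) - real (m choose Suc k) * x)" .
  have e: "Suc m - Suc k = Suc j" "m - k = Suc j" "m - Suc k = j" by (auto simp: m)
  have "(real (Suc k) - real (Suc m) * x) * Bernstein (Suc m) (Suc k) x
      = ((real (Suc k) - real (Suc m) * x) * real (Suc m choose Suc k)) * x ^ Suc k * (1 - x) ^ Suc j"
    by (simp only: Bernstein_def e mult.assoc)
  also have "\<dots> = real (Suc m) * x * (1 - x) * (Bernstein m k x - Bernstein m (Suc k) x)"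
    unfolding 3 by (simp only: Bernstein_def e power_Suc) (simp only: algebra_simps)
  finally show ?thesis .
qed

lemma sum_Bernstein_lower_deviation:
  "(\<Sum>k\<le>N. (real (Suc m) * x - real k) * Bernstein (Suc m) k x)
     = real (Suc m) * x * (1 - x) * Bernstein m N x"
proof (induction N)
  case 0
  show ?case by (simp add: Bernstein_def)
next
  case (Suc N)
  have "(real (Suc m) * x - real (Suc N)) * Bernstein (Suc m) (Suc N) x
    = - ((real (Suc N) - real (Suc m) * x) * Bernstein (Suc m) (Suc N) x)"
    by (simp add: algebra_simps)
  with Suc Bernstein_centred_telescope[of N m x] show ?case
    by (simp only: sum.atMost_Suc) (simp add: algebra_simps)
qed

text \<open>
  De Moivre's formula. The terms with \<open>x - k / n \<ge> 0\<close> are those with \<open>k \<le> \<lfloor>n x\<rfloor>\<close>, so the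
  telescoping sum stops there and leaves a single binomial probability.
\<close>

lemma sum_Bernstein_neg_part:
  assumes "0 < x" "x < 1" "n \<ge> 1"
  shows "(\<Sum>k\<le>n. Bernstein n k x * max 0 (x - real k / real n))
       = x * (1 - x) * Bernstein (n - 1) (nat \<lfloor>real n * x\<rfloor>) x"
proof -
  define N where "N = nat \<lfloor>real n * x\<rfloor>"
  obtain m where n: "n = Suc m" using assms by (cases n) auto
  have le: "k \<le> N \<longleftrightarrow> real k \<le> real n * x" for k
    using assms by (simp add: N_def le_nat_iff le_floor_iff)
  have "real N \<le> real n * x" using le by blast
  also have "\<dots> \<le> real n" using assms by (simp add: mult_left_le)
  finally have Nn: "N \<le> n" by simp
  have summand: "Bernstein n k x * max 0 (x - real k / real n)
     = (if k \<le> N then (real n * x - real k) * Bernstein n k x / real n else 0)" for k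
  proof -
    have "x - real k / real n = (real n * x - real k) / real n"
      using assms by (simp add: field_simps)
    moreover have "(0 \<le> (real n * x - real k) / real n) \<longleftrightarrow> k \<le> N"
      using assms by (simp add: le zero_le_divide_iff)
    ultimately show ?thesis by (auto simp: max_def)
  qed
  have "{k \<in> {..n}. k \<le> N} = {..N}" using Nn by auto
  then have "(\<Sum>k\<le>n. Bernstein n k x * max 0 (x - real k / real n))
     = (\<Sum>k\<le>N. (real n * x - real k) * Bernstein n k x) / real n"
    unfolding summand by (simp flip: sum.inter_filter add: sum_divide_distrib)
  also have "\<dots> = x * (1 - x) * Bernstein m N x"
    unfolding n by (subst sum_Bernstein_lower_deviation) simp
  finally show ?thesis by (simp add: N_def n)
qed

text \<open>The mean of the binomial law is \<open>n x\<close>, so both parts of the deviation have the same mean.\<close>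

lemma sum_Bernstein_pos_part:
  assumes "0 < x" "x < 1" "n \<ge> 1"
  shows "(\<Sum>k\<le>n. Bernstein n k x * max 0 (real k / real n - x))
       = x * (1 - x) * Bernstein (n - 1) (nat \<lfloor>real n * x\<rfloor>) x"
proof -
  have "(\<Sum>k\<le>n. Bernstein n k x * max 0 (real k / real n - x))
      = (\<Sum>k\<le>n. Bernstein n k x * max 0 (x - real k / real n)
           + (real k * Bernstein n k x / real n - x * Bernstein n k x))"
    by (intro sum.cong refl) (auto simp: max_def algebra_simps)
  also have "\<dots> = (\<Sum>k\<le>n. Bernstein n k x * max 0 (x - real k / real n))"
    using assms
    by (simp add: sum.distrib sum_subtractf flip: sum_divide_distrib sum_distrib_left)
  finally show ?thesis using sum_Bernstein_neg_part[OF assms] by simp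
qed

section \<open>Exponential moments of the binomial law\<close>

lemma sum_Bernstein_exp:
  "(\<Sum>k\<le>n. Bernstein n k x * exp (l * (real k - real n * x)))
     = (x * exp (l * (1 - x)) + (1 - x) * exp (- l * x)) ^ n"
proof -
  have "Bernstein n k x * exp (l * (real k - real n * x)) =
     of_nat (n choose k) * (x * exp (l * (1 - x))) ^ k * ((1 - x) * exp (- l * x)) ^ (n - k)"
    if "k \<le> n" for k
  proof -
    have "exp (l * (real k - real n * x)) = exp (real k * (l * (1 - x)) + real (n - k) * (- l * x))"
      using that by (simp add: of_nat_diff algebra_simps)
    also have "\<dots> = exp (l * (1 - x)) ^ k * exp (- l * x) ^ (n - k)"
      by (simp only: exp_add exp_of_nat_mult)
    finally show ?thesis by (simp add: Bernstein_def power_mult_distrib)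
  qed
  then show ?thesis unfolding binomial_ring by (intro sum.cong) auto
qed

lemma exp_le_taylor_cubic:
  fixes z :: real
  shows "exp z \<le> 1 + z + z\<^sup>2 / 2 + \<bar>z\<bar> ^ 3 / 6 * exp \<bar>z\<bar>"
proof -
  obtain t where t: "\<bar>t\<bar> \<le> \<bar>z\<bar>" "exp z = (\<Sum>m<3. z ^ m / fact m) + (exp t / fact 3) * z ^ 3"
    using Maclaurin_exp_le[of z 3] by auto
  have "exp t * z ^ 3 \<le> exp \<bar>z\<bar> * \<bar>z\<bar> ^ 3"
  proof -
    have "exp t * z ^ 3 \<le> exp t * \<bar>z\<bar> ^ 3"
      by (intro mult_left_mono) (auto simp flip: power_abs)
    also have "\<dots> \<le> exp \<bar>z\<bar> * \<bar>z\<bar> ^ 3" using t(1) by (intro mult_right_mono) auto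
    finally show ?thesis .
  qed
  then show ?thesis using t(2) by (simp add: eval_nat_numeral fact_numeral field_simps)
qed

text \<open>
  The left-hand side is the exponential moment of a centred Bernoulli variable, whose second moment
  is \<open>x (1 - x)\<close> and whose third absolute moment is \<open>x (1 - x) (x\<^sup>2 + (1 - x)\<^sup>2)\<close>. Its absolute value
  is at most 1, which makes the Taylor remainder uniform.
\<close>

lemma centred_bernoulli_exp_moment:
  fixes x l :: real
  assumes "0 < x" "x < 1"
  shows "x * exp (l * (1 - x)) + (1 - x) * exp (- l * x)
     \<le> exp (l\<^sup>2 * (x * (1 - x) / 2 * (1 + (x\<^sup>2 + (1 - x)\<^sup>2) / 3 * \<bar>l\<bar> * exp \<bar>l\<bar>)))"
proof -
  have b: "exp (l * u) \<le> 1 + l * u + (l * u)\<^sup>2 / 2 + \<bar>l\<bar> ^ 3 * \<bar>u\<bar> ^ 3 / 6 * exp \<bar>l\<bar>"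
    if "\<bar>u\<bar> \<le> 1" for u
  proof -
    have "\<bar>l * u\<bar> ^ 3 / 6 * exp \<bar>l * u\<bar> \<le> \<bar>l * u\<bar> ^ 3 / 6 * exp \<bar>l\<bar>"
      using that by (intro mult_left_mono) (auto simp: abs_mult mult_left_le)
    then show ?thesis
      using exp_le_taylor_cubic[of "l * u"] by (simp add: abs_mult power_mult_distrib)
  qed
  have "x * exp (l * (1 - x)) + (1 - x) * exp (l * (- x))
     \<le> x * (1 + l * (1 - x) + (l * (1 - x))\<^sup>2 / 2 + \<bar>l\<bar> ^ 3 * \<bar>1 - x\<bar> ^ 3 / 6 * exp \<bar>l\<bar>)
       + (1 - x) * (1 + l * (- x) + (l * (- x))\<^sup>2 / 2 + \<bar>l\<bar> ^ 3 * \<bar>- x\<bar> ^ 3 / 6 * exp \<bar>l\<bar>)"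
    using assms by (intro add_mono mult_left_mono b) auto
  also have "\<dots> = 1 + (l\<^sup>2 * (x * (1 - x) / 2)
       + (\<bar>l\<bar> ^ 3 * (x * (1 - x) * (x\<^sup>2 + (1 - x)\<^sup>2) / 6)) * exp \<bar>l\<bar>)"
    using assms by (simp add: power2_eq_square power3_eq_cube field_simps)
  also have "\<bar>l\<bar> ^ 3 = l\<^sup>2 * \<bar>l\<bar>" by (simp add: power3_eq_cube power2_eq_square flip: abs_mult)
  also have "1 + (l\<^sup>2 * (x * (1 - x) / 2)
       + (l\<^sup>2 * \<bar>l\<bar> * (x * (1 - x) * (x\<^sup>2 + (1 - x)\<^sup>2) / 6)) * exp \<bar>l\<bar>)
      = 1 + l\<^sup>2 * (x * (1 - x) / 2 * (1 + (x\<^sup>2 + (1 - x)\<^sup>2) / 3 * \<bar>l\<bar> * exp \<bar>l\<bar>))"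
    by (simp add: field_simps)
  also have "\<dots> \<le> exp (l\<^sup>2 * (x * (1 - x) / 2 * (1 + (x\<^sup>2 + (1 - x)\<^sup>2) / 3 * \<bar>l\<bar> * exp \<bar>l\<bar>)))"
    by (rule exp_ge_add_one_self)
  finally show ?thesis by simp
qed

text \<open>
  The parameters \<open>l = 1 / sqrt n\<close> and \<open>l = - 1 / sqrt n\<close> satisfy \<open>n l\<^sup>2 = 1\<close>, so the \<open>n\<close>-th power of the
  one-trial bound has an exponent that stays bounded in \<open>n\<close>. The factor 2 pays for the absolute
  value, through \<open>exp \<bar>z\<bar> \<le> exp z + exp (- z)\<close>.
\<close>

lemma sum_Bernstein_exp_abs_le:
  fixes x :: real
  assumes "0 < x" "x < 1" "n \<ge> 1"
  shows "(\<Sum>k\<le>n. Bernstein n k x * exp (sqrt (real n) * \<bar>real k / real n - x\<bar>))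
     \<le> 2 * exp (x * (1 - x) / 2 *
              (1 + (x\<^sup>2 + (1 - x)\<^sup>2) / (3 * sqrt (real n)) * exp (1 / sqrt (real n))))"
    (is "_ \<le> 2 * exp ?E")
proof -
  define s where "s = sqrt (real n)"
  have s: "s > 0" "s\<^sup>2 = real n" using assms by (auto simp: s_def)
  have one: "(\<Sum>k\<le>n. Bernstein n k x * exp (l * (real k - real n * x))) \<le> exp ?E"
    if l: "\<bar>l\<bar> = 1 / s" for l
  proof -
    have l2: "l\<^sup>2 = 1 / real n" using s l
      by (metis power2_abs power_one_over)
    have "(x * exp (l * (1 - x)) + (1 - x) * exp (- l * x)) ^ n
       \<le> exp (l\<^sup>2 * (x * (1 - x) / 2 * (1 + (x\<^sup>2 + (1 - x)\<^sup>2) / 3 * \<bar>l\<bar> * exp \<bar>l\<bar>))) ^ n"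
      using assms by (intro power_mono centred_bernoulli_exp_moment add_nonneg_nonneg) auto
    also have "\<dots> = exp ?E"
      using assms s by (simp add: l2 l s_def[symmetric] flip: exp_of_nat_mult)
    finally show ?thesis unfolding sum_Bernstein_exp .
  qed
  have "(\<Sum>k\<le>n. Bernstein n k x * exp (s * \<bar>real k / real n - x\<bar>))
    \<le> (\<Sum>k\<le>n. Bernstein n k x * exp (1 / s * (real k - real n * x))
           + Bernstein n k x * exp (- (1 / s) * (real k - real n * x)))"
  proof (rule sum_mono)
    fix k
    have "s * (real k / real n - x) = 1 / s * (real k - real n * x)"
      using s by (simp add: s(2)[symmetric] field_simps power2_eq_square)
    then have "s * \<bar>real k / real n - x\<bar> = \<bar>1 / s * (real k - real n * x)\<bar>"
      using s by (metis abs_mult abs_of_pos)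
    then have "exp (s * \<bar>real k / real n - x\<bar>)
       \<le> exp (1 / s * (real k - real n * x)) + exp (- (1 / s) * (real k - real n * x))"
      by (auto simp: abs_if)
    then show "Bernstein n k x * exp (s * \<bar>real k / real n - x\<bar>)
       \<le> Bernstein n k x * exp (1 / s * (real k - real n * x))
           + Bernstein n k x * exp (- (1 / s) * (real k - real n * x))"
      using Bernstein_nonneg[of x n k] assms by (simp add: mult_left_mono flip: distrib_left)
  qed
  also have "\<dots> \<le> exp ?E + exp ?E"
    unfolding sum.distrib using s by (intro add_mono one) auto
  finally show ?thesis by (simp add: s_def)
qed

section \<open>Integrals dominated by an exponentially weighted step function\<close>

lemma has_integral_exp_neg:
  fixes s :: real
  assumes "s > 0" "a \<le> b"
  shows "((\<lambda>t. exp (- (s * t))) has_integral (exp (- (s * a)) - exp (- (s * b))) / s) {a..b}"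
proof -
  have "((\<lambda>t. exp (- (s * t))) has_integral
      (- exp (- (s * b)) / s - (- exp (- (s * a)) / s))) {a..b}"
    using assms
    by (intro fundamental_theorem_of_calculus)
       (auto simp flip: has_real_derivative_iff_has_vector_derivative
             intro!: derivative_eq_intros)
  then show ?thesis by (simp add: diff_divide_distrib)
qed

text \<open>
  On \<open>[0, d]\<close> the factor \<open>exp (- s d)\<close> is at most \<open>exp (- s t)\<close>, so it suffices to integrate
  \<open>w k exp (- s t)\<close> over the pieces \<open>k < s exp (- s t) \<le> k + 1\<close>. In the variable
  \<open>u = s exp (- s t)\<close>, where \<open>exp (- s t) dt = - du / s\<^sup>2\<close>, their lengths are at most 1, so each
  contributes at most \<open>w k / s\<^sup>2\<close>.
\<close>

lemma integral_le_exp_weighted_sum: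
  fixes h :: "real \<Rightarrow> real" and w :: "nat \<Rightarrow> real"
  assumes h: "(h has_integral I) {0..d}" and s: "s > 0"
    and m: "real m < s" "s \<le> real m + 1"
    and w0: "\<And>k. k \<le> m \<Longrightarrow> w k \<ge> 0"
    and bound: "\<And>t k. \<lbrakk>0 < t; t < d; k \<le> m; real k < s * exp (- (s * t))\<rbrakk> \<Longrightarrow> \<bar>h t\<bar> \<le> w k"
  shows "\<bar>I\<bar> \<le> exp (s * d) * ((\<Sum>k = 0..m. w k) / s\<^sup>2)"
proof -
  \<comment> \<open>\<open>[a k, b k]\<close> contains the part in \<open>(0, d)\<close> of the \<open>k\<close>-th piece. The piece for \<open>k = 0\<close> is unbounded and
      is cut off at \<open>d\<close>, or at its left end point if that lies beyond \<open>d\<close>.\<close>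
  define a where "a k = max 0 (ln (s / (real k + 1)) / s)" for k :: nat
  define b where "b k = (if k = 0 then max d (a 0) else ln (s / real k) / s)" for k :: nat
  define H where "H t = (\<Sum>k = 0..m. w k * (if t \<in> {a k..b k} then exp (- (s * t)) else 0))" for t
  have ab: "a k \<le> b k" if "k \<le> m" for k
    using that s m by (auto simp: a_def b_def divide_right_mono frac_le)
  have len: "(exp (- (s * a k)) - exp (- (s * b k))) / s \<le> 1 / s\<^sup>2" if k: "k \<le> m" for k
  proof -
    have "exp (- (s * a k)) \<le> exp (- ln (s / (real k + 1)))"
      using s by (simp add: a_def max_def field_simps)
    also have "\<dots> = (real k + 1) / s" using s by (simp add: exp_minus)
    finally have 1: "exp (- (s * a k)) \<le> (real k + 1) / s" .
    have 2: "exp (- (s * b k)) \<ge> real k / s"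
      using s k by (auto simp: b_def exp_minus)
    have "exp (- (s * a k)) - exp (- (s * b k)) \<le> 1 / s"
      using 1 2 s by (simp add: add_divide_distrib)
    from divide_right_mono[OF this, of s] show ?thesis using s by (simp add: power2_eq_square)
  qed
  have H: "(H has_integral (\<Sum>k = 0..m. w k * ((exp (- (s * a k)) - exp (- (s * b k))) / s))) UNIV"
    unfolding H_def using s ab
    by (intro has_integral_sum has_integral_mult_right finite_atLeastAtMost
              has_integral_restrict_UNIV[THEN iffD2] has_integral_exp_neg) auto
  have H0: "0 \<le> H t" for t
    unfolding H_def using w0 by (intro sum_nonneg) auto
  have J: "((\<lambda>t. if t \<in> {0<..<d} then exp (- (s * d)) * h t else 0) has_integral exp (- (s * d)) * I) UNIV"
    unfolding has_integral_restrict_UNIV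
    using has_integral_mult_right[OF h] has_integral_Icc_iff_Ioo by blast
  have le: "norm (if t \<in> {0<..<d} then exp (- (s * d)) * h t else 0) \<le> H t" for t
  proof (cases "t \<in> {0<..<d}")
    case True
    \<comment> \<open>the index of the step that contains \<open>t\<close>\<close>
    define k where "k = nat (\<lceil>s * exp (- (s * t))\<rceil> - 1)"
    have pos: "s * exp (- (s * t)) > 0" using s by simp
    then have kk: "real k < s * exp (- (s * t))" "s * exp (- (s * t)) \<le> real k + 1"
      unfolding k_def by linarith+
    have "s * exp (- (s * t)) \<le> s" using True s by (simp add: mult_left_le)
    then have km: "k \<le> m" using kk m by linarith
    have "ln (s * exp (- (s * t))) \<le> ln (real k + 1)"
      using kk pos by (subst ln_le_cancel_iff) auto
    then have "ln (s / (real k + 1)) \<le> s * t"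
      using s by (simp add: ln_mult ln_div)
    then have ta: "a k \<le> t" using True s by (simp add: a_def field_simps)
    have tb: "t \<le> b k"
    proof (cases "k = 0")
      case True
      then show ?thesis using \<open>t \<in> {0<..<d}\<close> by (simp add: b_def le_max_iff_disj)
    next
      case False
      then have "ln (real k) \<le> ln (s * exp (- (s * t)))"
        using kk pos by (subst ln_le_cancel_iff) auto
      then have "s * t \<le> ln (s / real k)" using s False by (simp add: ln_mult ln_div)
      then show ?thesis using False s by (simp add: b_def field_simps)
    qed
    have "norm (exp (- (s * d)) * h t) \<le> exp (- (s * t)) * w k"
      unfolding norm_mult using True s bound[of t k] km kk
      by (intro mult_mono) auto
    also have "\<dots> = (\<Sum>j\<in>{k}. w j * (if t \<in> {a j..b j} then exp (- (s * t)) else 0))"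
      using ta tb by simp
    also have "\<dots> \<le> H t"
      unfolding H_def using km w0 by (intro sum_mono2) auto
    finally show ?thesis using True by simp
  qed (use H0 in auto)
  have "norm (exp (- (s * d)) * I)
      \<le> (\<Sum>k = 0..m. w k * ((exp (- (s * a k)) - exp (- (s * b k))) / s))"
    using Henstock_Kurzweil_Integration.integral_norm_bound_integral
        [of _ UNIV H, OF has_integral_integrable[OF J] has_integral_integrable[OF H]] le
      integral_unique[OF J] integral_unique[OF H] by simp
  also have "\<dots> \<le> (\<Sum>k = 0..m. w k * (1 / s\<^sup>2))"
    using w0 len by (intro sum_mono mult_left_mono) auto
  finally have "exp (- (s * d)) * \<bar>I\<bar> \<le> (\<Sum>k = 0..m. w k) / s\<^sup>2"
    by (simp add: abs_mult sum_divide_distrib)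
  then have "exp (s * d) * (exp (- (s * d)) * \<bar>I\<bar>) \<le> exp (s * d) * ((\<Sum>k = 0..m. w k) / s\<^sup>2)"
    by (intro mult_left_mono) auto
  then show ?thesis by (simp add: mult.assoc[symmetric] flip: exp_add)
qed

section \<open>The modulus of continuity at a point\<close>

lemma omega_bdd_above:
  fixes g :: "real \<Rightarrow> real"
  assumes "bounded (g ` {0..1})"
  shows "bdd_above {\<bar>g (x + u) - g x\<bar> |u. x + u \<in> {0..1} \<and> \<bar>u\<bar> \<le> \<theta>}"
proof -
  obtain C where C: "\<And>y. y \<in> {0..1} \<Longrightarrow> \<bar>g y\<bar> \<le> C"
    using assms unfolding bounded_iff real_norm_def by (meson imageI)
  show ?thesis
    by (rule bdd_aboveI[where M = "C + \<bar>g x\<bar>"]) (use C abs_triangle_ineq4 in \<open>fastforce\<close>)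
qed

lemma le_omega:
  assumes "bounded (g ` {0..1})" "x + u \<in> {0..1}" "\<bar>u\<bar> \<le> \<theta>"
  shows "\<bar>g (x + u) - g x\<bar> \<le> omega x g \<theta>"
  unfolding omega_def using assms by (intro cSup_upper omega_bdd_above) blast+

lemma omega_nonneg:
  assumes "bounded (g ` {0..1})" "x \<in> {0..1}" "0 \<le> \<theta>"
  shows "0 \<le> omega x g \<theta>"
  using le_omega[of g x 0 \<theta>] assms by simp

text \<open>
  Two points of the unit interval have distance at most 1, so the modulus is constant from \<open>\<theta> = 1\<close> on.
\<close>

lemma omega_ext_infinity:
  assumes "x \<in> {0..1}"
  shows "omega_ext x g \<infinity> = omega x g 1"
proof -
  have "omega x g \<theta> = omega x g 1" if "\<theta> \<ge> 1" for \<theta>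
    unfolding omega_def using assms that by (intro arg_cong[where f = Sup]) fastforce
  then have "\<forall>\<^sub>F \<theta> in at_top. omega x g \<theta> = omega x g 1"
    using eventually_at_top_linorder by blast
  then have "(omega x g \<longlongrightarrow> omega x g 1) at_top"
    by (rule tendsto_eventually)
  then show ?thesis by (simp add: omega_ext_def tendsto_Lim)
qed

lemma omega_ext_nonneg:
  assumes "bounded (g ` {0..1})" "x \<in> {0..1}" "0 \<le> \<theta>"
  shows "0 \<le> omega_ext x g \<theta>"
  using assms omega_nonneg[OF assms(1,2)] omega_ext_infinity[OF assms(2), of g]
  by (cases \<theta>) (auto simp: omega_ext_def)

lemma le_omega_ext:
  assumes "bounded (g ` {0..1})" "x \<in> {0..1}" "x + u \<in> {0..1}" "ereal \<bar>u\<bar> \<le> \<theta>"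
  shows "\<bar>g (x + u) - g x\<bar> \<le> omega_ext x g \<theta>"
proof (cases \<theta>)
  case (real r)
  then show ?thesis using le_omega[of g x u r] assms by (simp add: omega_ext_def)
next
  case PInf
  then show ?thesis
    using le_omega[of g x u 1] omega_ext_infinity[OF assms(2), of g] assms by auto
next
  case MInf
  then show ?thesis using assms by simp
qed

section \<open>Removing the jump at a point\<close>

lemma jump_removed_at [simp]: "jump_removed f x x = 0"
  by (simp add: jump_removed_def)

lemma jump_removed_right: "x < y \<Longrightarrow> y \<le> 1 \<Longrightarrow> jump_removed f x y = f y - right_lim f x"
  by (simp add: jump_removed_def)

lemma jump_removed_left: "y < x \<Longrightarrow> 0 \<le> y \<Longrightarrow> jump_removed f x y = f y - left_lim f x"
  by (simp add: jump_removed_def)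

lemma bounded_jump_removed:
  assumes "bounded (f ` {0..1})"
  shows "bounded (jump_removed f x ` {0..1})"
proof -
  obtain C where C: "\<And>y. y \<in> {0..1} \<Longrightarrow> \<bar>f y\<bar> \<le> C"
    using assms unfolding bounded_iff real_norm_def by (meson imageI)
  have "\<bar>jump_removed f x y\<bar> \<le> C + \<bar>right_lim f x\<bar> + \<bar>left_lim f x\<bar>" if "y \<in> {0..1}" for y
    using C[OF that] by (auto simp: jump_removed_def indicator_def)
  then show ?thesis unfolding bounded_iff real_norm_def by blast
qed

lemma B01_set_integrable:
  assumes "f \<in> B01 x"
  shows "set_integrable lebesgue {0..1} f"
proof -
  obtain C where C: "\<And>y. y \<in> {0..1} \<Longrightarrow> \<bar>f y\<bar> \<le> C"
    using assms unfolding B01_def bounded_iff real_norm_def by (blast intro: imageI)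
  show ?thesis
    by (rule measurable_bounded_by_integrable_imp_absolutely_integrable[where g = "\<lambda>_. C"])
       (use assms C in \<open>auto simp: B01_def\<close>)
qed

lemma primitive_has_integral:
  assumes f: "f \<in> B01 x" and prim: "is_primitive_from x f \<phi>" and x: "x \<in> {0..1}" and y: "y \<in> {0..1}"
  shows "x \<le> y \<Longrightarrow> (f has_integral \<phi> y - \<phi> x) {x..y}"
    and "y \<le> x \<Longrightarrow> (f has_integral \<phi> x - \<phi> y) {y..x}"
proof -
  have *: "(f has_integral (LINT u:{a<..<b}|lebesgue. f u)) {a..b}" if "0 \<le> a" "b \<le> 1" for a b
    unfolding has_integral_Icc_iff_Ioo
    by (intro has_integral_set_lebesgue set_integrable_subset[OF B01_set_integrable[OF f]])
       (use that in auto)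
  have **: "\<phi> y - \<phi> x = (LINT u=ereal x..ereal y|lebesgue. f u)"
    using prim y by (simp add: is_primitive_from_def)
  show "x \<le> y \<Longrightarrow> (f has_integral \<phi> y - \<phi> x) {x..y}"
    using *[of x y] x y ** by (simp add: interval_lebesgue_integral_def)
  show "y \<le> x \<Longrightarrow> (f has_integral \<phi> x - \<phi> y) {y..x}"
  proof (cases "y = x")
    case False
    assume "y \<le> x"
    with False have "\<phi> x - \<phi> y = (LINT u:{y<..<x}|lebesgue. f u)"
      using ** by (simp add: interval_lebesgue_integral_def)
    then show ?thesis using *[of y x] x y by simp
  qed (use has_integral_refl(2)[of f x] in simp)
qed

text \<open>
  Both sides of \<open>x\<close> are reduced to an integral over the distance \<open>t\<close> from \<open>x\<close>, by a translation or by
  a translation and a reflection. A distance \<open>t\<close> with \<open>k < s exp (- s t)\<close>, where \<open>s = sqrt n\<close>, is less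
  than \<open>log (s / k) / s\<close> and so less than \<open>log (n / k) / s\<close>, the argument of the modulus in the
  \<open>k\<close>-th term.
\<close>

lemma primitive_remainder_le:
  fixes x y :: real and n :: nat and \<phi> f :: "real \<Rightarrow> real"
  assumes x: "x \<in> {0..1}" and y: "y \<in> {0..1}" and n: "n \<ge> 1"
    and f: "f \<in> B01 x" and prim: "is_primitive_from x f \<phi>"
  shows "\<bar>\<phi> y - \<phi> x - right_lim f x * max 0 (y - x) + left_lim f x * max 0 (x - y)\<bar>
    \<le> exp (sqrt (real n) * \<bar>y - x\<bar>) * (1 / real n *
         (\<Sum>k = 0..nat (\<lceil>sqrt (real n)\<rceil> - 1).
            omega_ext x (jump_removed f x) (ereal (1 / sqrt (real n)) * log_ratio n k)))"
proof -
  define s where "s = sqrt (real n)"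
  define m where "m = nat (\<lceil>s\<rceil> - 1)"
  define g where "g = jump_removed f x"
  define \<theta> where "\<theta> k = ereal (1 / s) * log_ratio n k" for k
  have s: "s > 0" "s\<^sup>2 = real n" and s1: "s \<ge> 1" using n by (auto simp: s_def)
  have sn: "s \<le> real n" using self_le_power[of s 2] s s1 by simp
  have m: "real m < s" "s \<le> real m + 1" using s1 unfolding m_def by linarith+
  have g: "bounded (g ` {0..1})"
    unfolding g_def using f by (intro bounded_jump_removed) (simp add: B01_def)
  have \<theta>0: "0 \<le> \<theta> k" if "k \<le> m" for k
    using that m sn s by (auto simp: \<theta>_def log_ratio_def)
  have w0: "0 \<le> omega_ext x g (\<theta> k)" if "k \<le> m" for k
    using omega_ext_nonneg[OF g x \<theta>0[OF that]] .
  have t\<theta>: "ereal t \<le> \<theta> k" if "real k < s * exp (- (s * t))" for t k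
  proof (cases "k = 0")
    case False
    then have "ln (real k) \<le> ln (s * exp (- (s * t)))"
      using that s by (subst ln_le_cancel_iff) auto
    then have "s * t \<le> ln s - ln (real k)" using s by (simp add: ln_mult)
    also have "\<dots> \<le> ln (real n) - ln (real k)" using s sn by simp
    also have "\<dots> = ln (real n / real k)" using n False by (simp add: ln_div)
    finally show ?thesis using s False by (simp add: \<theta>_def log_ratio_def field_simps)
  qed (use s in \<open>simp add: \<theta>_def log_ratio_def\<close>)
  have w: "\<bar>g (x + u)\<bar> \<le> omega_ext x g (\<theta> k)"
    if "x + u \<in> {0..1}" "real k < s * exp (- (s * \<bar>u\<bar>))" for u k
    using le_omega_ext[OF g x that(1) t\<theta>[OF that(2)]] by (simp add: g_def)
  note concl = integral_le_exp_weighted_sum[where s = s and m = m and w = "\<lambda>k. omega_ext x g (\<theta> k)",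
      OF _ s(1) m w0]
  have "\<bar>\<phi> y - \<phi> x - right_lim f x * max 0 (y - x) + left_lim f x * max 0 (x - y)\<bar>
     \<le> exp (s * \<bar>y - x\<bar>) * ((\<Sum>k = 0..m. omega_ext x g (\<theta> k)) / s\<^sup>2)"
  proof (cases "x \<le> y")
    case True
    have "((\<lambda>t. f (t + x)) has_integral \<phi> y - \<phi> x) {0..y - x}"
      using has_integral_shift_real_ivl[OF primitive_has_integral(1)[OF f prim x y True], of x] by simp
    from has_integral_diff[OF this has_integral_const_real[of "right_lim f x"]]
    have I: "((\<lambda>t. f (t + x) - right_lim f x) has_integral
        \<phi> y - \<phi> x - right_lim f x * (y - x)) {0..y - x}"
      using True by (simp add: mult.commute)
    have "\<bar>f (t + x) - right_lim f x\<bar> \<le> omega_ext x g (\<theta> k)"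
      if "0 < t" "t < y - x" "real k < s * exp (- (s * t))" for t k
      using w[of t k] that x y by (simp add: g_def jump_removed_right add.commute)
    from concl[OF I _ this] show ?thesis using True by simp
  next
    case False
    then have le: "y \<le> x" by simp
    have "((\<lambda>t. f (- t)) has_integral \<phi> x - \<phi> y) {- x..- y}"
      using primitive_has_integral(2)[OF f prim x y le] by simp
    from has_integral_shift_real_ivl[OF this, of "- x"]
    have "((\<lambda>t. f (x - t)) has_integral \<phi> x - \<phi> y) {0..x - y}" by simp
    from has_integral_diff[OF this has_integral_const_real[of "left_lim f x"]]
    have I: "((\<lambda>t. f (x - t) - left_lim f x) has_integral
        \<phi> x - \<phi> y - left_lim f x * (x - y)) {0..x - y}"
      using le by (simp add: mult.commute)
    have "\<bar>f (x - t) - left_lim f x\<bar> \<le> omega_ext x g (\<theta> k)"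
      if "0 < t" "t < x - y" "real k < s * exp (- (s * t))" for t k
      using w[of "- t" k] that x y by (simp add: g_def jump_removed_left)
    from concl[OF I _ this]
    have "\<bar>\<phi> x - \<phi> y - left_lim f x * (x - y)\<bar>
      \<le> exp (s * (x - y)) * ((\<Sum>k = 0..m. omega_ext x g (\<theta> k)) / s\<^sup>2)" by simp
    moreover have "\<bar>\<phi> y - \<phi> x - right_lim f x * max 0 (y - x) + left_lim f x * max 0 (x - y)\<bar>
       = \<bar>\<phi> x - \<phi> y - left_lim f x * (x - y)\<bar>"
      using le by (simp add: max_def abs_minus_commute algebra_simps)
    ultimately show ?thesis using le by simp
  qed
  then show ?thesis unfolding s(2) by (simp add: s_def m_def g_def \<theta>_def)
qed

section \<open>Bernstein polynomials of a primitive of a function with a jump\<close>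

lemma prob_binomial_eq_Bernstein:
  assumes "0 \<le> x" "x \<le> 1" "0 \<le> i"
  shows "measure_pmf.prob (binomial_pmf m x) {k. int k = i} = Bernstein m (nat i) x"
proof -
  have "{k. int k = i} = {nat i}" using assms by auto
  then show ?thesis using assms by (simp add: measure_pmf_single Bernstein_def)
qed

theorem corollary5p5:
  fixes x :: real and n :: nat and \<phi> f g :: "real \<Rightarrow> real"
  assumes "0 < x" and "x < 1"
    and "n \<ge> 1"
    and "\<phi> \<in> DB01 x"
    and "f \<in> B01 x"
    and "is_primitive_from x f \<phi>"
    and "g = jump_removed f x"
  shows "\<bar>bernstein_op n \<phi> x - \<phi> x
           - x * (1 - x) * measure_pmf.prob (binomial_pmf (n - 1) x) {k. int k = \<lfloor>real n * x\<rfloor>}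
               * (right_lim f x - left_lim f x)\<bar>
         \<le> 2 * exp (x * (1 - x) / 2 *
                   (1 + (x\<^sup>2 + (1 - x)\<^sup>2) / (3 * sqrt (real n)) * exp (1 / sqrt (real n))))
           * (1 / real n *
              (\<Sum>k = 0..nat (\<lceil>sqrt (real n)\<rceil> - 1).
                 omega_ext x g (ereal (1 / sqrt (real n)) * log_ratio n k)))"
    (is "\<bar>_ - _ - x * (1 - x) * ?P * _\<bar> \<le> 2 * exp ?E * ?A")
proof -
  \<comment> \<open>what is left of the increment of \<open>\<phi>\<close> at the \<open>k\<close>-th node once the ramp is removed\<close>
  define R where "R k = \<phi> (real k / real n) - \<phi> x - right_lim f x * max 0 (real k / real n - x)
      + left_lim f x * max 0 (x - real k / real n)" for k
  have R: "\<bar>R k\<bar> \<le> exp (sqrt (real n) * \<bar>real k / real n - x\<bar>) * ?A" if "k \<le> n" for k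
    unfolding R_def assms(7)
    by (rule primitive_remainder_le) (use assms that in auto)
  have A: "0 \<le> ?A"
    using order_trans[OF abs_ge_zero R[of 0]] by (simp only: zero_le_mult_iff exp_ge_zero le0) simp
  have P: "?P = Bernstein (n - 1) (nat \<lfloor>real n * x\<rfloor>) x"
    using assms by (intro prob_binomial_eq_Bernstein) auto
  have "bernstein_op n \<phi> x - \<phi> x = (\<Sum>k\<le>n. Bernstein n k x * (\<phi> (real k / real n) - \<phi> x))"
    by (simp add: bernstein_op_def algebra_simps sum_subtractf flip: sum_distrib_left)
  also have "\<dots> = (\<Sum>k\<le>n. Bernstein n k x * R k)
      + right_lim f x * (\<Sum>k\<le>n. Bernstein n k x * max 0 (real k / real n - x))
      - left_lim f x * (\<Sum>k\<le>n. Bernstein n k x * max 0 (x - real k / real n))"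
    unfolding sum_distrib_left sum.distrib[symmetric] sum_subtractf[symmetric] R_def
    by (intro sum.cong refl) (simp add: algebra_simps)
  also have "\<dots> = (\<Sum>k\<le>n. Bernstein n k x * R k)
      + x * (1 - x) * ?P * (right_lim f x - left_lim f x)"
    unfolding P sum_Bernstein_pos_part[OF assms(1-3)] sum_Bernstein_neg_part[OF assms(1-3)]
    by (simp add: algebra_simps)
  finally have "\<bar>bernstein_op n \<phi> x - \<phi> x - x * (1 - x) * ?P * (right_lim f x - left_lim f x)\<bar>
      = \<bar>\<Sum>k\<le>n. Bernstein n k x * R k\<bar>" by simp
  also have "\<dots> \<le> (\<Sum>k\<le>n. Bernstein n k x * (exp (sqrt (real n) * \<bar>real k / real n - x\<bar>) * ?A))"
  proof (intro order_trans[OF sum_abs] sum_mono)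
    fix k assume "k \<in> {..n}"
    then show "\<bar>Bernstein n k x * R k\<bar>
       \<le> Bernstein n k x * (exp (sqrt (real n) * \<bar>real k / real n - x\<bar>) * ?A)"
      unfolding abs_mult using R[of k] Bernstein_nonneg[of x n k] assms(1,2)
      by (simp only: abs_of_nonneg less_imp_le atMost_iff mult_left_mono)
  qed
  also have "\<dots> = (\<Sum>k\<le>n. Bernstein n k x * exp (sqrt (real n) * \<bar>real k / real n - x\<bar>)) * ?A"
    by (simp only: sum_distrib_right mult.assoc)
  also have "\<dots> \<le> 2 * exp ?E * ?A"
    using A assms by (intro mult_right_mono sum_Bernstein_exp_abs_le)
  finally show ?thesis .
qed

end
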